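(* For any isolate-free graph $G$ with maximum degree $\Delta(G)$, $$TC(G)\le \left(\frac{\Delta(G)+2}{2}\right)^2=\frac{\Delta(G)^2}{4}+\Delta(G)+1.$$
   Context: All graphs are finite and simple (no loops or multiple edges). A graph is isolate-free if it has no vertex of degree $0$. A set $T\subseteq V$ of vertices of a graph $G(V,E)$ is a total dominating set if every vertex of $V$ is adjacent to at least one vertex of $T$. Two disjoint sets $A,B\subset V$ form a total coalition if neither $A$ nor $B$ is a total dominating set, but $A\cup B$ is. A total coalition partition of $G$ is a partition $\Psi=\{C_1,\dots,C_k\}$ of $V$ into non-empty classes such that for every $i$ there exists $j\neq i$ such that $C_i$ and $C_j$ form a total coalition. The total coalition number $TC(G)$ of an isolate-free graph $G$ is the maximum cardinality (number of classes) of a total coalition partition of $G$. *)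

theory Defs
  imports Complex_Main "HOL-Library.Disjoint_Sets" "Graph_Theory.Digraph"
begin

text \<open>
  A finite simple graph is a digraph satisfying the locale \<^locale>\<open>graph\<close>: finite, symmetric,
  without loops and without parallel arcs.  Each undirected edge is thus a pair of opposite arcs,
  and the degree of a vertex is its out-degree.
\<close>

definition isolate_free :: "('a, 'b) pre_digraph \<Rightarrow> bool" where
  "isolate_free G \<longleftrightarrow> (\<forall>v\<in>verts G. out_degree G v \<noteq> 0)"

text \<open>Unspecified for the graph with no vertices.\<close>

definition max_degree :: "('a, 'b) pre_digraph \<Rightarrow> nat" where
  "max_degree G = Max (out_degree G ` verts G)"

definition total_dominating :: "('a, 'b) pre_digraph \<Rightarrow> 'a set \<Rightarrow> bool" where
  "total_dominating G T \<longleftrightarrow> T \<subseteq> verts G \<and> (\<forall>v\<in>verts G. \<exists>t\<in>T. v \<rightarrow>\<^bsub>G\<^esub> t)"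

definition total_coalition :: "('a, 'b) pre_digraph \<Rightarrow> 'a set \<Rightarrow> 'a set \<Rightarrow> bool" where
  "total_coalition G A B \<longleftrightarrow>
     A \<subseteq> verts G \<and> B \<subseteq> verts G \<and> A \<inter> B = {} \<and>
     \<not> total_dominating G A \<and> \<not> total_dominating G B \<and> total_dominating G (A \<union> B)"

definition total_coalition_partition :: "('a, 'b) pre_digraph \<Rightarrow> 'a set set \<Rightarrow> bool" where
  "total_coalition_partition G \<Psi> \<longleftrightarrow>
     partition_on (verts G) \<Psi> \<and>
     (\<forall>A\<in>\<Psi>. \<exists>B\<in>\<Psi>. B \<noteq> A \<and> total_coalition G A B)"

text \<open>
  For a finite isolate-free graph the set below is finite and nonempty (every such graph has a
  total coalition partition), so the maximum is attained; otherwise the value is unspecified.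
\<close>

definition total_coalition_number :: "('a, 'b) pre_digraph \<Rightarrow> nat" where
  "total_coalition_number G = Max {card \<Psi> |\<Psi>. total_coalition_partition G \<Psi>}"

end

theory Submission
  imports Defs
begin

text \<open>
  Let \<open>\<Gamma>\<close> be the graph whose vertices are the classes of a total coalition partition and whose
  edges are its total coalitions. It has no isolated vertex, so it is spanned by disjoint stars,
  with \<open>s\<close> centres say. A class \<open>c\<close> is not total dominating, so it misses the neighbourhood of
  some vertex \<open>v\<close>. The at most \<open>\<Delta>\<close> classes that meet this neighbourhood form a vertex cover of
  \<open>\<Gamma>\<close> without \<open>c\<close>; if \<open>c\<close> is a centre, the cover contains all leaves of \<open>c\<close> and at least one
  vertex of each of the other \<open>s - 1\<close> stars. Hence every star has at most \<open>\<Delta> + 2 - s\<close> vertices,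
  and there are at most \<open>s (\<Delta> + 2 - s) \<le> (\<Delta> + 2)\<^sup>2 / 4\<close> classes.

  Total coalition partitions exist: in a partition into as few as possible sets that are not
  total dominating, any two classes form a total coalition, since otherwise they could be merged.
\<close>

section \<open>Spanning forests of nontrivial stars\<close>

text \<open>The map \<open>f\<close> sends each vertex to the centre of its star, and every star has a leaf.\<close>

definition star_forest :: "('a \<Rightarrow> 'a \<Rightarrow> bool) \<Rightarrow> 'a set \<Rightarrow> ('a \<Rightarrow> 'a) \<Rightarrow> bool" where
  "star_forest R U f \<longleftrightarrow>
     (\<forall>x\<in>U. f x \<in> U \<and> f (f x) = f x \<and> (f x \<noteq> x \<longrightarrow> R x (f x)) \<and>
       (\<exists>z\<in>U. z \<noteq> f x \<and> f z = f x))"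

text \<open>Vertices are covered one at a time, each together with some neighbour; at most the star
  containing that neighbour has to change.\<close>

lemma spanning_star_forest:
  assumes "finite V"
    and sym: "\<And>x y. R x y \<Longrightarrow> R y x"
    and nbr: "\<And>x. x \<in> V \<Longrightarrow> \<exists>y\<in>V. y \<noteq> x \<and> R x y"
  shows "\<exists>f. star_forest R V f"
proof -
  \<comment> \<open>\<open>U\<close> may exceed \<open>W\<close>: covering a vertex can force a
    neighbour outside \<open>W\<close> to be covered too.\<close>
  have "\<exists>U f. W \<subseteq> U \<and> U \<subseteq> V \<and> star_forest R U f" if "finite W" "W \<subseteq> V" for W
    using that
  proof (induction W rule: finite_induct)
    case empty
    have "star_forest R {} id" by (simp add: star_forest_def)
    then show ?case by blast
  next
    case (insert x W)
    then obtain U f where U: "W \<subseteq> U" "U \<subseteq> V" and sf: "star_forest R U f" by blast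
    have "x \<in> V" using insert.prems by simp
    show ?case
    proof (cases "x \<in> U")
      case True
      then show ?thesis using U sf by blast
    next
      case False
      obtain y where y: "y \<in> V" "y \<noteq> x" "R x y" using nbr \<open>x \<in> V\<close> by blast
      let ?P = "\<lambda>U g u. g u \<in> U \<and> g (g u) = g u \<and> (g u \<noteq> u \<longrightarrow> R u (g u)) \<and>
        (\<exists>z\<in>U. z \<noteq> g u \<and> g z = g u)"
      have f: "f u \<in> U" "f (f u) = f u" "f u \<noteq> u \<Longrightarrow> R u (f u)"
        "\<exists>z\<in>U. z \<noteq> f u \<and> f z = f u" if "u \<in> U" for u
        using sf that by (auto simp: star_forest_def)
      \<comment> \<open>The neighbour \<open>y\<close> is uncovered, a centre, a leaf whose star has
        another leaf \<open>z\<close>, or the only leaf of its star.\<close>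
      consider "y \<notin> U" | "y \<in> U" "f y = y"
        | z where "y \<in> U" "f y \<noteq> y" "z \<in> U" "z \<noteq> y" "z \<noteq> f y" "f z = f y"
        | "y \<in> U" "f y \<noteq> y" "\<forall>z\<in>U. f z = f y \<longrightarrow> z = y \<or> z = f y"
        by blast
      then have "\<exists>g. star_forest R (insert x (insert y U)) g"
      proof cases
        case 1
        have "star_forest R (insert x (insert y U)) (f(x := y, y := y))"
          unfolding star_forest_def
        proof
          fix u assume "u \<in> insert x (insert y U)"
          then consider "u = x" | "u = y" | "u \<in> U" "u \<noteq> x" "u \<noteq> y" using \<open>x \<notin> U\<close> by blast
          then show "?P (insert x (insert y U)) (f(x := y, y := y)) u"
          proof cases
            case 3
            then have "f u \<noteq> x" "f u \<noteq> y" using f(1) \<open>x \<notin> U\<close> \<open>y \<notin> U\<close> by metis+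
            moreover obtain z where "z \<in> U" "z \<noteq> f u" "f z = f u" using f(4) 3 by blast
            ultimately show ?thesis
              using 3 f(1-3)[of u] \<open>x \<notin> U\<close> \<open>y \<notin> U\<close> by (intro conjI bexI[of _ z]) auto
          qed (use y in auto)
        qed
        then show ?thesis by blast
      next
        case 2
        have "star_forest R (insert x (insert y U)) (f(x := y))"
          unfolding star_forest_def
        proof
          fix u assume "u \<in> insert x (insert y U)"
          then consider "u = x" | "u \<in> U" "u \<noteq> x" using 2 \<open>x \<notin> U\<close> by blast
          then show "?P (insert x (insert y U)) (f(x := y)) u"
          proof cases
            case A: 2
            then have "f u \<noteq> x" using f(1) \<open>x \<notin> U\<close> by metis
            moreover obtain z where "z \<in> U" "z \<noteq> f u" "f z = f u" using f(4) A by blast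
            ultimately show ?thesis
              using A 2 f(1-3)[of u] \<open>x \<notin> U\<close> by (intro conjI bexI[of _ z]) auto
          qed (use y 2 in auto)
        qed
        then show ?thesis by blast
      next
        case (3 z)
        \<comment> \<open>\<open>y\<close> leaves its star, which keeps the leaf \<open>z\<close>,
          and becomes the centre of a new star with leaf \<open>x\<close>.\<close>
        have "star_forest R (insert x (insert y U)) (f(x := y, y := y))"
          unfolding star_forest_def
        proof
          fix u assume "u \<in> insert x (insert y U)"
          then consider "u = x" | "u = y" | "u \<in> U" "u \<noteq> x" "u \<noteq> y" using \<open>x \<notin> U\<close> by blast
          then show "?P (insert x (insert y U)) (f(x := y, y := y)) u"
          proof cases
            case A: 3
            then have "f u \<noteq> x" "f u \<noteq> y" using f(1,2) \<open>x \<notin> U\<close> 3 by metis+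
            \<comment> \<open>If \<open>f u = f y\<close>, then \<open>z\<close> serves as
              \<open>w\<close>; otherwise \<open>y\<close> is not in the star of
              \<open>u\<close>.\<close>
            moreover obtain w where "w \<in> U" "w \<noteq> f u" "f w = f u" "w \<noteq> y"
              using f(4)[OF A(1)] 3 by metis
            ultimately show ?thesis
              using A f(1-3)[of u] \<open>x \<notin> U\<close> by (intro conjI bexI[of _ w]) auto
          qed (use y in auto)
        qed
        then show ?thesis by blast
      next
        case 4
        \<comment> \<open>The star of \<open>y\<close> is a single edge: \<open>y\<close> takes over as its centre.\<close>
        let ?g = "f(x := y, y := y, f y := y)"
        have "f y \<noteq> x" using f(1) 4 \<open>x \<notin> U\<close> by metis
        have "star_forest R (insert x (insert y U)) ?g"
          unfolding star_forest_def
        proof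
          fix u assume "u \<in> insert x (insert y U)"
          then consider "u = x" | "u = y" | "u = f y" | "u \<in> U" "u \<noteq> x" "u \<noteq> y" "u \<noteq> f y"
            using \<open>x \<notin> U\<close> by blast
          then show "?P (insert x (insert y U)) ?g u"
          proof cases
            case A: 4
            then have "f u \<noteq> f y" using 4 by blast
            then have "f u \<noteq> x" "f u \<noteq> y" using A f(1,2) \<open>x \<notin> U\<close> by metis+
            moreover obtain w where "w \<in> U" "w \<noteq> f u" "f w = f u"
              using f(4)[OF A(1)] by blast
            moreover have "w \<noteq> y" "w \<noteq> f y"
              using \<open>f w = f u\<close> \<open>f u \<noteq> f y\<close> f(2)[OF 4(1)] by auto
            ultimately show ?thesis
              using A \<open>f u \<noteq> f y\<close> f(1-3)[of u] \<open>x \<notin> U\<close> by (intro conjI bexI[of _ w]) auto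
          next
            case 3
            then show ?thesis using y 4 sym[OF f(3)[OF 4(1)]] \<open>f y \<noteq> x\<close> by auto
          qed (use y \<open>f y \<noteq> x\<close> in auto)
        qed
        then show ?thesis by blast
      qed
      moreover have "insert x W \<subseteq> insert x (insert y U)" "insert x (insert y U) \<subseteq> V"
        using U y \<open>x \<in> V\<close> by auto
      ultimately show ?thesis by blast
    qed
  qed
  \<comment> \<open>For \<open>W = V\<close> the inclusions force \<open>U = V\<close>.\<close>
  from this[OF \<open>finite V\<close> order_refl] show ?thesis by (metis subset_antisym)
qed

section \<open>Counting stars by small vertex covers\<close>

lemma card_le_of_small_covers:
  fixes \<Delta> :: nat
  assumes fin: "finite V"
    and sym: "\<And>x y. R x y \<Longrightarrow> R y x"
    and nbr: "\<And>x. x \<in> V \<Longrightarrow> \<exists>y\<in>V. y \<noteq> x \<and> R x y"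
    and cover: "\<And>x. x \<in> V \<Longrightarrow>
      \<exists>S\<subseteq>V. x \<notin> S \<and> card S \<le> \<Delta> \<and> (\<forall>y\<in>V. \<forall>z\<in>V. R y z \<longrightarrow> y \<in> S \<or> z \<in> S)"
  shows "4 * card V \<le> (\<Delta> + 2)\<^sup>2"
proof -
  obtain f where sf: "star_forest R V f"
    using spanning_star_forest[OF fin sym nbr] by blast
  then have f: "f u \<in> V" "f (f u) = f u" "f u \<noteq> u \<Longrightarrow> R u (f u)"
    "\<exists>z\<in>V. z \<noteq> f u \<and> f z = f u" if "u \<in> V" for u
    using that by (auto simp: star_forest_def)
  define C where "C = f ` V"
  define star where "star c = {x\<in>V. f x = c}" for c
  have "finite C" by (simp add: C_def fin)
  have star: "card (star c) + card C \<le> \<Delta> + 2" if "c \<in> C" for c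
  proof -
    have c: "c \<in> V" "f c = c" using that f by (auto simp: C_def)
    obtain S where S: "S \<subseteq> V" "c \<notin> S" "card S \<le> \<Delta>"
      and S_cover: "\<And>y z. y \<in> V \<Longrightarrow> z \<in> V \<Longrightarrow> R y z \<Longrightarrow> y \<in> S \<or> z \<in> S"
      using cover[OF c(1)] by blast
    have "finite S" using S(1) fin finite_subset by blast
    \<comment> \<open>A leaf of \<open>c\<close> is adjacent to \<open>c\<close>, which is not in
      \<open>S\<close>, so the cover contains the leaf.\<close>
    have "star c - {c} \<subseteq> S \<inter> star c"
      using f(3) c S(2) S_cover by (fastforce simp: star_def)
    then have "card (star c) - 1 \<le> card (S \<inter> star c)"
      using card_mono[of "S \<inter> star c" "star c - {c}"] \<open>finite S\<close> c by (simp add: star_def)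
    \<comment> \<open>Every other star has an edge from its centre \<open>d\<close> to a leaf
      \<open>z\<close>; an end lying in \<open>S\<close> is mapped to \<open>d\<close>.\<close>
    moreover have "C - {c} \<subseteq> f ` (S - star c)"
    proof
      fix d assume d: "d \<in> C - {c}"
      then have "d \<in> V" "f d = d" using f by (auto simp: C_def)
      moreover obtain z where "z \<in> V" "z \<noteq> d" "f z = d" using f(4) \<open>f d = d\<close> \<open>d \<in> V\<close> by metis
      ultimately have "z \<in> S \<or> d \<in> S" using f(3) S_cover by metis
      moreover have "z \<notin> star c" "d \<notin> star c"
        using d \<open>f z = d\<close> \<open>f d = d\<close> by (auto simp: star_def)
      ultimately show "d \<in> f ` (S - star c)"
        using \<open>f z = d\<close> \<open>f d = d\<close> by (metis DiffI imageI)
    qed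
    then have "card C - 1 \<le> card (S - star c)"
      using that surj_card_le[of "S - star c" "C - {c}" f] \<open>finite S\<close> by simp
    \<comment> \<open>The centre \<open>c\<close> was removed once from its star and once from
      \<open>C\<close>; this accounts for the 2 in the bound.\<close>
    moreover have "card S = card (S \<inter> star c) + card (S - star c)"
      using \<open>finite S\<close> by (metis card_Int_Diff)
    ultimately show ?thesis using S(3) by linarith
  qed
  have "card V = (\<Sum>c\<in>C. card (star c))"
    unfolding C_def star_def using sum.image_gen[OF fin, of "\<lambda>_. 1::nat" f] by simp
  also have "\<dots> \<le> (\<Sum>c\<in>C. \<Delta> + 2 - card C)"
    using star by (intro sum_mono) fastforce
  also have "\<dots> = card C * (\<Delta> + 2 - card C)" by simp
  finally have le: "card V \<le> card C * (\<Delta> + 2 - card C)" .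
  show ?thesis
  proof (cases "C = {}")
    case True
    then show ?thesis using le by simp
  next
    case False
    \<comment> \<open>This makes the natural-number subtraction \<open>\<Delta> + 2 - card C\<close>
      exact.\<close>
    then have "card C \<le> \<Delta> + 2" using star by (metis add_leD2 ex_in_conv)
    then obtain m where m: "\<Delta> + 2 = card C + m" using le_Suc_ex by blast
    \<comment> \<open>The square of \<open>card C - m\<close> is nonnegative; over the integers the
      difference is not truncated.\<close>
    have "int (4 * (card C * m)) \<le> int ((card C + m)\<^sup>2)"
      using zero_le_power2[of "int (card C) - int m"]
      by (simp add: power2_eq_square algebra_simps)
    then have "4 * (card C * m) \<le> (card C + m)\<^sup>2" by (simp only: of_nat_le_iff)
    then show ?thesis using le m by simp
  qed
qed

section \<open>Vertex covers from neighbourhoods\<close>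

context fin_digraph
begin

lemma out_degree_le_max_degree:
  assumes "v \<in> verts G"
  shows "out_degree G v \<le> max_degree G"
  unfolding max_degree_def using assms by simp

text \<open>Each such class contains the head of an arc leaving \<open>v\<close>, and by
  disjointness the arc determines the class.\<close>

lemma card_classes_meeting_nbhd:
  assumes "partition_on (verts G) P" "v \<in> verts G"
  shows "card {A\<in>P. \<exists>t\<in>A. v \<rightarrow>\<^bsub>G\<^esub> t} \<le> max_degree G"
proof -
  define cls where "cls a = (THE A. A \<in> P \<and> head G a \<in> A)" for a
  have "{A\<in>P. \<exists>t\<in>A. v \<rightarrow>\<^bsub>G\<^esub> t} \<subseteq> cls ` out_arcs G v"
  proof
    fix A assume "A \<in> {A\<in>P. \<exists>t\<in>A. v \<rightarrow>\<^bsub>G\<^esub> t}"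
    then obtain a where A: "A \<in> P" "head G a \<in> A" and a: "a \<in> out_arcs G v"
      by (auto simp: arcs_ends_conv out_arcs_def arc_to_ends_def)
    have "cls a = A"
      unfolding cls_def using A partition_onD2[OF assms(1)]
      by (intro the_equality) (auto simp: disjoint_def)
    then show "A \<in> cls ` out_arcs G v" using a by blast
  qed
  then have "card {A\<in>P. \<exists>t\<in>A. v \<rightarrow>\<^bsub>G\<^esub> t} \<le> out_degree G v"
    unfolding out_degree_def by (intro surj_card_le finite_out_arcs)
  then show ?thesis using out_degree_le_max_degree[OF assms(2)] by simp
qed

lemma card_total_coalition_partition:
  assumes "total_coalition_partition G P"
  shows "4 * card P \<le> (max_degree G + 2)\<^sup>2"
proof (rule card_le_of_small_covers[where R = "total_coalition G"])
  have part: "partition_on (verts G) P"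
    and partner: "\<And>A. A \<in> P \<Longrightarrow> \<exists>B\<in>P. B \<noteq> A \<and> total_coalition G A B"
    using assms unfolding total_coalition_partition_def by auto
  show "finite P" using finite_elements[OF _ part] by simp
  show "total_coalition G B A" if "total_coalition G A B" for A B
    using that unfolding total_coalition_def by (auto simp: Un_commute)
  show "\<exists>B\<in>P. B \<noteq> A \<and> total_coalition G A B" if "A \<in> P" for A
    using partner that .
  show "\<exists>S\<subseteq>P. A \<notin> S \<and> card S \<le> max_degree G \<and>
      (\<forall>B\<in>P. \<forall>C\<in>P. total_coalition G B C \<longrightarrow> B \<in> S \<or> C \<in> S)" if "A \<in> P" for A
  proof -
    have "\<not> total_dominating G A" "A \<subseteq> verts G"
      using partner[OF that] unfolding total_coalition_def by auto
    then obtain v where v: "v \<in> verts G" "\<not> (\<exists>t\<in>A. v \<rightarrow>\<^bsub>G\<^esub> t)"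
      unfolding total_dominating_def by blast
    \<comment> \<open>The union of a coalition dominates \<open>v\<close>, so one of its members
      meets the neighbourhood of \<open>v\<close>; hence \<open>?S\<close> is a vertex cover
      avoiding \<open>A\<close>.\<close>
    let ?S = "{B\<in>P. \<exists>t\<in>B. v \<rightarrow>\<^bsub>G\<^esub> t}"
    have "B \<in> ?S \<or> C \<in> ?S" if "B \<in> P" "C \<in> P" "total_coalition G B C" for B C
    proof -
      have "total_dominating G (B \<union> C)" using that(3) unfolding total_coalition_def by simp
      then obtain t where "t \<in> B \<union> C" "v \<rightarrow>\<^bsub>G\<^esub> t"
        using v(1) unfolding total_dominating_def by metis
      then show ?thesis using that(1,2) by auto
    qed
    moreover have "?S \<subseteq> P" "A \<notin> ?S" using v(2) by simp_all
    ultimately show ?thesis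
      using card_classes_meeting_nbhd[OF part v(1)]
      by (intro exI[of _ ?S] conjI ballI impI) assumption+
  qed
qed

end

section \<open>Existence of total coalition partitions\<close>

text \<open>Ensures that the maximum defining the total coalition number is taken over a nonempty
  set.\<close>

lemma (in digraph) total_coalition_partition_exists:
  assumes "isolate_free G"
  shows "\<exists>P. total_coalition_partition G P"
proof -
  define Q where
    "Q P \<longleftrightarrow> partition_on (verts G) P \<and> (\<forall>A\<in>P. \<not> total_dominating G A)" for P
  \<comment> \<open>Without loops, \<open>{v}\<close> contains no neighbour of
    \<open>v\<close>.\<close>
  have "Q ((\<lambda>v. {v}) ` verts G)"
  proof -
    have "\<not> total_dominating G {v}" if "v \<in> verts G" for v
      using that adj_not_same unfolding total_dominating_def by blast
    moreover have "partition_on (verts G) ((\<lambda>v. {v}) ` verts G)"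
      by (rule partition_on_singletons)
    ultimately show ?thesis by (simp add: Q_def)
  qed
  then obtain P where QP: "Q P" and min: "\<And>P'. Q P' \<Longrightarrow> card P \<le> card P'"
    using ex_has_least_nat[of Q _ card] by blast
  then have part: "partition_on (verts G) P" and nd: "\<And>A. A \<in> P \<Longrightarrow> \<not> total_dominating G A"
    by (auto simp: Q_def)
  have "finite P" using finite_elements[OF _ part] by simp
  have sub: "A \<subseteq> verts G" if "A \<in> P" for A using part that unfolding partition_on_def by auto
  have merge: "total_dominating G (A \<union> B)" if AB: "A \<in> P" "B \<in> P" "A \<noteq> B" for A B
  proof (rule ccontr)
    assume nd': "\<not> total_dominating G (A \<union> B)"
    \<comment> \<open>Merging \<open>A\<close> and \<open>B\<close> would preserve \<open>Q\<close>
      with fewer classes.\<close>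
    let ?P = "insert (A \<union> B) (P - {A, B})"
    have "\<Union>?P = verts G" using partition_onD1[OF part] AB by auto
    moreover have "disjoint ?P"
      using partition_onD2[OF part] AB by (auto simp: disjoint_def)
    moreover have "{} \<notin> ?P" using partition_onD3[OF part] AB by auto
    ultimately have "partition_on (verts G) ?P" by (simp add: partition_on_def)
    then have "Q ?P" using nd nd' by (auto simp: Q_def)
    then have "card P \<le> card ?P" by (rule min)
    also have "\<dots> \<le> Suc (card (P - {A, B}))" by (simp add: card_insert_if \<open>finite P\<close>)
    finally have "card P \<le> Suc (card (P - {A, B}))" .
    moreover have "card (P - {A, B}) = card P - 2"
      using AB \<open>finite P\<close> by (simp add: card_Diff_subset)
    moreover have "card P \<ge> 2" using AB \<open>finite P\<close> card_mono[of P "{A, B}"] by simp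
    ultimately show False by linarith
  qed
  have "\<exists>B\<in>P. B \<noteq> A \<and> total_coalition G A B" if A: "A \<in> P" for A
  proof -
    \<comment> \<open>Since no vertex is isolated, the whole vertex set is total dominating, so
      \<open>A\<close> cannot be the only class.\<close>
    have "total_dominating G (verts G)"
      unfolding total_dominating_def
    proof (intro conjI ballI order_refl)
      fix v assume "v \<in> verts G"
      then have "card (out_arcs G v) \<noteq> 0"
        using assms unfolding isolate_free_def out_degree_def by blast
      then have "out_arcs G v \<noteq> {}" by (metis card.empty)
      then obtain a where a: "a \<in> arcs G" "tail G a = v" by (auto simp: out_arcs_def)
      then have "v \<rightarrow>\<^bsub>G\<^esub> head G a" by (force simp: arcs_ends_conv)
      then show "\<exists>t\<in>verts G. v \<rightarrow>\<^bsub>G\<^esub> t" using a(1) head_in_verts by blast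
    qed
    then have "P \<noteq> {A}" using nd[OF A] partition_onD1[OF part] by auto
    then obtain B where B: "B \<in> P" "B \<noteq> A" using A by blast
    then have "A \<inter> B = {}" using A partition_onD2[OF part] by (auto simp: disjoint_def)
    then show ?thesis
      using A B sub nd merge[OF A B(1) B(2)[symmetric]] unfolding total_coalition_def by auto
  qed
  then show ?thesis using part unfolding total_coalition_partition_def by blast
qed

theorem theorem3p5:
  fixes G :: "('a, 'b) pre_digraph"
  assumes "graph G" and "isolate_free G"
  shows "real (total_coalition_number G) \<le> ((real (max_degree G) + 2) / 2)\<^sup>2
    \<and> ((real (max_degree G) + 2) / 2)\<^sup>2 = (real (max_degree G))\<^sup>2 / 4 + real (max_degree G) + 1"
proof
  interpret graph G by fact
  let ?N = "{card P |P. total_coalition_partition G P}"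
  have bound: "4 * n \<le> (max_degree G + 2)\<^sup>2" if "n \<in> ?N" for n
    using that card_total_coalition_partition by blast
  \<comment> \<open>The bound also yields finiteness of \<open>?N\<close>, so that the maximum is
    attained.\<close>
  have "n \<le> (max_degree G + 2)\<^sup>2" if "n \<in> ?N" for n
    using bound[OF that] by linarith
  then have "finite ?N" using finite_nat_set_iff_bounded_le by blast
  moreover have "?N \<noteq> {}" using total_coalition_partition_exists[OF assms(2)] by blast
  ultimately have "total_coalition_number G \<in> ?N"
    unfolding total_coalition_number_def by (rule Max_in)
  then have "real (4 * total_coalition_number G) \<le> real ((max_degree G + 2)\<^sup>2)"
    using bound of_nat_le_iff by blast
  then show "real (total_coalition_number G) \<le> ((real (max_degree G) + 2) / 2)\<^sup>2"
    by (simp add: power_divide add.commute)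
  show "((real (max_degree G) + 2) / 2)\<^sup>2 = (real (max_degree G))\<^sup>2 / 4 + real (max_degree G) + 1"
    by (simp add: power2_eq_square field_simps)
qed

end
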